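(* $k_n\ge \dfrac{2\log_2 n}{\log_2 14.864}+O(1)$, i.e. $k_n\ge 0.51364\log_2 n+O(1)$.
   Context: A system of $k$ stacks in series consists of an input queue, stacks $1,\dots,k$, and an output queue. Moves $m_1,\dots,m_{k+1}$: $m_1$ moves the front of the input queue onto stack 1; $m_i$ ($2\le i\le k$) pops stack $i-1$ and pushes onto stack $i$; $m_{k+1}$ pops stack $k$ and enqueues at the back of the output queue; a move is illegal if its source is empty. A permutation $\pi\in S_n$ is generated by $k$ stacks if some legal sequence of moves, starting with $1,\dots,n$ (front to back) in the input queue and everything else empty, ends with $\pi(1),\dots,\pi(n)$ (front to back) in the output queue and everything else empty. $P_n^k$ is the set of such $\pi$, and $k_n$ is the smallest $k$ with $P_n^k=S_n$ (the number of stacks in series needed to sort any permutation of $n$ elements). *)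

theory Defs
  imports Complex_Main "HOL-Combinatorics.Permutations"
begin

text \<open>A configuration of k stacks in series is a list of k+2 lists:
  cell 0 is the input queue (front = head), cells 1..k are the stacks
  (top = head), cell k+1 is the output queue (front = head, enqueue at the back).\<close>

definition stack_move :: "nat \<Rightarrow> nat \<Rightarrow> nat list list \<Rightarrow> nat list list \<Rightarrow> bool" where
  "stack_move k i cs cs' \<longleftrightarrow>
     1 \<le> i \<and> i \<le> k + 1 \<and> length cs = k + 2 \<and> cs ! (i - 1) \<noteq> [] \<and>
     (let x = hd (cs ! (i - 1)); ds = cs[i - 1 := tl (cs ! (i - 1))] in
      cs' = (if i = k + 1 then ds[k + 1 := (cs ! (k + 1)) @ [x]]
             else ds[i := x # (cs ! i)]))"

definition stack_step :: "nat \<Rightarrow> nat list list \<Rightarrow> nat list list \<Rightarrow> bool" where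
  "stack_step k cs cs' \<longleftrightarrow> (\<exists>i. stack_move k i cs cs')"

definition init_config :: "nat \<Rightarrow> nat \<Rightarrow> nat list list" where
  "init_config k n = [1..<n+1] # replicate k [] @ [[]]"

definition final_config :: "nat \<Rightarrow> nat \<Rightarrow> (nat \<Rightarrow> nat) \<Rightarrow> nat list list" where
  "final_config k n \<pi> = replicate (k + 1) [] @ [map \<pi> [1..<n+1]]"

definition Sym :: "nat \<Rightarrow> (nat \<Rightarrow> nat) set" where
  "Sym n = {\<pi>. \<pi> permutes {1..n}}"

definition Pgen :: "nat \<Rightarrow> nat \<Rightarrow> (nat \<Rightarrow> nat) set" where
  "Pgen n k = {\<pi>. \<pi> permutes {1..n} \<and> (stack_step k)\<^sup>*\<^sup>* (init_config k n) (final_config k n \<pi>)}"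

definition stacks_needed :: "nat \<Rightarrow> nat" where
  "stacks_needed n = (LEAST k. Pgen n k = Sym n)"

end

theory Submission
  imports Defs "HOL-Library.Sublist"
begin

text \<open>
  Cut the \<open>k\<close> stacks into blocks of two: if \<open>N\<close> bounds the number of orders in which
  two stacks can output \<open>n\<close> items, then \<open>n! \<le> N ^ ((k + 1) div 2)\<close>.

  To bound \<open>N\<close>, encode a run of two stacks as a word in the moves \<open>a\<close> (input to stack 1),
  \<open>b\<close> (stack 1 to stack 2) and \<open>c\<close> (stack 2 to output), each occurring \<open>n\<close> times. The
  replacements \<open>ac \<rightarrow> ca\<close>, \<open>abbc \<rightarrow> bcab\<close> and \<open>aabbbc \<rightarrow> bcaabb\<close> do not change the
  effect of a run and lower the number of pairs (\<open>a\<close> before \<open>c\<close>), so only words avoiding the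
  three left-hand sides matter. Giving \<open>a, b, c\<close> the weights 0.5, 0.27, 0.5, the words of any fixed
  length that avoid them have total weight at most 3, whence \<open>N \<le> 3 (400/27)^n\<close>. Since
  \<open>400/27 < 14.864\<close>, the bound follows from \<open>n! \<ge> (n/e)^n\<close>.

  Because \<open>stacks_needed\<close> is a \<open>LEAST\<close>, one also has to know that some number of stacks suffices;
  \<open>3 n\<close> do, since three consecutive stacks can move any one item to the end of the sequence.
\<close>

section \<open>Stacks in series as lists of cells\<close>

text \<open>Trades index updates for a splitting of the configuration around the two adjacent cells
  of a move, so later arguments only have to exhibit \<open>ps\<close> and \<open>qs\<close>. The
  case \<open>qs = []\<close> is a move into the output queue, which grows at its back.\<close>

lemma stack_step_iff:
  "stack_step k cs cs' \<longleftrightarrow>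
     (\<exists>ps x s t qs. cs = ps @ (x # s) # t # qs \<and> length ps + length qs = k \<and>
        cs' = ps @ s # (if qs = [] then t @ [x] else x # t) # qs)"
    (is "?L \<longleftrightarrow> ?R")
proof
  assume ?L
  then obtain i where m: "stack_move k i cs cs'"
    by (auto simp: stack_step_def)
  then have i: "1 \<le> i" "i \<le> k + 1" and len: "length cs = k + 2" and ne: "cs ! (i - 1) \<noteq> []"
    by (auto simp: stack_move_def)
  define ps t qs where "ps = take (i - 1) cs" and "t = cs ! i" and "qs = drop (Suc i) cs"
  obtain x s where xs: "cs ! (i - 1) = x # s"
    using ne by (cases "cs ! (i - 1)") auto
  have "drop (i - 1) cs = (x # s) # drop i cs"
    using i len xs Cons_nth_drop_Suc[of "i - 1" cs] by simp
  also have "drop i cs = t # qs"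
    using i len Cons_nth_drop_Suc[of i cs] by (simp add: t_def qs_def)
  finally have cs: "cs = ps @ (x # s) # t # qs"
    unfolding ps_def by (metis append_take_drop_id)
  have lps: "length ps = i - 1" and lqs: "length qs = k + 1 - i"
    using i len by (auto simp: ps_def qs_def)
  have qs: "qs = [] \<longleftrightarrow> i = k + 1"
    using lqs i by (metis diff_is_0_eq diff_self_eq_0 le_antisym length_0_conv)
  have u1: "cs[i - 1 := s] = ps @ s # t # qs"
    using lps by (simp add: cs list_update_append)
  have u2: "(ps @ s # t # qs)[i := y] = ps @ s # y # qs" for y
  proof -
    have "i - length ps = Suc 0" using lps i by simp
    moreover have "\<not> i < length ps" using lps i by simp
    ultimately show ?thesis by (simp add: list_update_append)
  qed
  have "cs' = (if i = k + 1 then (cs[i - 1 := s])[i := t @ [x]] else (cs[i - 1 := s])[i := x # t])"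
    using m xs by (auto simp: stack_move_def Let_def t_def)
  then have "cs' = ps @ s # (if qs = [] then t @ [x] else x # t) # qs"
    unfolding u1 u2 qs by simp
  then show ?R
    using cs lps lqs i by (intro exI[of _ ps] exI[of _ x] exI[of _ s] exI[of _ t] exI[of _ qs]) auto
next
  assume ?R
  then obtain ps x s t qs where cs: "cs = ps @ (x # s) # t # qs" "length ps + length qs = k"
    "cs' = ps @ s # (if qs = [] then t @ [x] else x # t) # qs"
    by blast
  have "length ps = k \<longleftrightarrow> qs = []"
    using cs(2) by auto
  then have "stack_move k (Suc (length ps)) cs cs'"
    using cs by (auto simp: stack_move_def Let_def nth_append list_update_append)
  then show ?L
    by (auto simp: stack_step_def)
qed

section \<open>Cutting a series of stacks in two\<close>

abbreviation loaded :: "nat \<Rightarrow> nat list \<Rightarrow> nat list list" where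
  "loaded k xs \<equiv> xs # replicate k [] @ [[]]"

abbreviation unloaded :: "nat \<Rightarrow> nat list \<Rightarrow> nat list list" where
  "unloaded k ys \<equiv> replicate (k + 1) [] @ [ys]"

text \<open>The input is an arbitrary list because the sequence passed on by one block of stacks is
  the input of the next.\<close>

definition outputs :: "nat \<Rightarrow> nat list \<Rightarrow> nat list set" where
  "outputs k xs = {ys. (stack_step k)\<^sup>*\<^sup>* (loaded k xs) (unloaded k ys)}"

text \<open>Here \<open>ys\<close> logs the items that have passed from stack \<open>j\<close> to stack \<open>j + 1\<close>; the last
  \<open>k\<close> stacks see this log as a prefix of their input queue.\<close>

lemma series_split:
  assumes "(stack_step (j + k))\<^sup>*\<^sup>* (loaded (j + k) xs) cs"
  shows "length cs = j + k + 2 \<and>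
    (\<exists>ys. (stack_step j)\<^sup>*\<^sup>* (loaded j xs) (take (j + 1) cs @ [ys]) \<and>
      (\<forall>zs. (stack_step k)\<^sup>*\<^sup>* (loaded k (ys @ zs)) (zs # drop (j + 1) cs)))"
  using assms
proof (induction rule: rtranclp_induct)
  case base
  have eq: "loaded (j + k) xs = (xs # replicate j []) @ (replicate k [] @ [[]])"
    by (simp add: replicate_add)
  have "take (j + 1) (loaded (j + k) xs) = xs # replicate j []"
    "drop (j + 1) (loaded (j + k) xs) = replicate k [] @ [[]]"
    unfolding eq by simp_all
  then show ?case
    by (auto intro!: exI[of _ "[]"])
next
  case (step cs cs')
  from step.IH obtain ys where len: "length cs = j + k + 2"
    and run1: "(stack_step j)\<^sup>*\<^sup>* (loaded j xs) (take (j + 1) cs @ [ys])"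
    and run2: "\<And>zs. (stack_step k)\<^sup>*\<^sup>* (loaded k (ys @ zs)) (zs # drop (j + 1) cs)"
    by blast
  from step.hyps(2) obtain ps x s t qs where cs: "cs = ps @ (x # s) # t # qs"
    and l: "length ps + length qs = j + k"
    and cs': "cs' = ps @ s # (if qs = [] then t @ [x] else x # t) # qs"
    unfolding stack_step_iff by blast
  have len': "length cs' = j + k + 2"
    using l by (simp add: cs')
  consider (left) "length ps < j" | (mid) "length ps = j" | (right) "length ps > j"
    by linarith
  then show ?case
  proof cases
    case left
    \<comment> \<open>The first \<open>j + 1\<close> cells consist of \<open>ps\<close>, the two
      cells of the move and \<open>d\<close> cells of \<open>qs\<close>; the log \<open>ys\<close>
      then plays the output queue.\<close>
    define d where "d = j - Suc (length ps)"
    have d: "j + 1 - length ps = Suc (Suc d)"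
      using left by (simp add: d_def)
    have qs: "qs \<noteq> []"
      using left l by auto
    have dq: "d \<le> length qs"
      using left l by (simp add: d_def)
    have "stack_step j (take (j + 1) cs @ [ys]) (take (j + 1) cs' @ [ys])"
      unfolding stack_step_iff
      using left d dq qs
      by (intro exI[of _ ps] exI[of _ x] exI[of _ s] exI[of _ t] exI[of _ "take d qs @ [ys]"])
        (auto simp: cs cs' d_def)
    with run1 have "(stack_step j)\<^sup>*\<^sup>* (loaded j xs) (take (j + 1) cs' @ [ys])"
      by simp
    moreover have "drop (j + 1) cs' = drop (j + 1) cs"
      using left d by (simp add: cs cs')
    ultimately show ?thesis
      using run2 len' by metis
  next
    case mid
    have "stack_step j (take (j + 1) cs @ [ys]) (take (j + 1) cs' @ [ys @ [x]])"
      unfolding stack_step_iff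
      using mid
      by (intro exI[of _ ps] exI[of _ x] exI[of _ s] exI[of _ ys] exI[of _ "[]"])
        (auto simp: cs cs')
    with run1 have run1': "(stack_step j)\<^sup>*\<^sup>* (loaded j xs) (take (j + 1) cs' @ [ys @ [x]])"
      by simp
    \<comment> \<open>The item crossing the cut is logged on the left and leaves the input queue on
      the right. The right-hand run is therefore taken with \<open>x\<close> still at the front of
      the remaining queue, which is why \<open>zs\<close> is quantified.\<close>
    have "(stack_step k)\<^sup>*\<^sup>* (loaded k ((ys @ [x]) @ zs)) (zs # drop (j + 1) cs')" for zs
    proof -
      have "stack_step k ((x # zs) # drop (j + 1) cs) (zs # drop (j + 1) cs')"
        unfolding stack_step_iff
        using mid l
        by (intro exI[of _ "[]"] exI[of _ x] exI[of _ zs] exI[of _ t] exI[of _ qs])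
          (auto simp: cs cs')
      with run2[of "x # zs"] show ?thesis
        by simp
    qed
    with run1' len' show ?thesis
      by blast
  next
    case right
    have "(stack_step k)\<^sup>*\<^sup>* (loaded k (ys @ zs)) (zs # drop (j + 1) cs')" for zs
    proof -
      have "stack_step k (zs # drop (j + 1) cs) (zs # drop (j + 1) cs')"
        unfolding stack_step_iff
        using right l
        by (intro exI[of _ "zs # drop (j + 1) ps"] exI[of _ x] exI[of _ s] exI[of _ t] exI[of _ qs])
          (auto simp: cs cs')
      with run2[of zs] show ?thesis
        by simp
    qed
    moreover have "take (j + 1) cs' = take (j + 1) cs"
      using right by (simp add: cs cs')
    ultimately show ?thesis
      using run1 len' by metis
  qed
qed

lemma outputs_split:
  assumes "zs \<in> outputs (j + k) xs"
  obtains ys where "ys \<in> outputs j xs" "zs \<in> outputs k ys"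
proof -
  have eq: "unloaded (j + k) zs = replicate (j + 1) [] @ (replicate k [] @ [zs])"
    by (simp add: replicate_add)
  have "take (j + 1) (unloaded (j + k) zs) = replicate (j + 1) []"
    "drop (j + 1) (unloaded (j + k) zs) = replicate k [] @ [zs]"
    unfolding eq by simp_all
  with series_split[of j k xs "unloaded (j + k) zs"] assms
  obtain ys where "(stack_step j)\<^sup>*\<^sup>* (loaded j xs) (unloaded j ys)"
    "\<forall>ws. (stack_step k)\<^sup>*\<^sup>* (loaded k (ys @ ws)) (ws # replicate k [] @ [zs])"
    by (auto simp: outputs_def)
  \<comment> \<open>With nothing left behind it, the log is the entire input of the last
    \<open>k\<close> stacks.\<close>
  from this(1) spec[OF this(2), of "[]"] show ?thesis
    by (intro that[of ys]) (auto simp: outputs_def)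
qed

section \<open>Enough stacks sort everything\<close>

lemma stack_to_stack:
  assumes "length ps + length qs = k" "qs \<noteq> []"
  shows "stack_step k (ps @ (x # s) # t # qs) (ps @ s # (x # t) # qs)"
  unfolding stack_step_iff using assms by fastforce

lemma pour:
  assumes "length ps + length qs = k" "qs \<noteq> []"
  shows "(stack_step k)\<^sup>*\<^sup>* (ps @ (u @ s) # t # qs) (ps @ s # (rev u @ t) # qs)"
proof (induction u arbitrary: t)
  case (Cons x u)
  have "stack_step k (ps @ (x # u @ s) # t # qs) (ps @ (u @ s) # (x # t) # qs)"
    using stack_to_stack[OF assms] .
  with Cons[of "x # t"] show ?case
    by (simp add: converse_rtranclp_into_rtranclp)
qed simp

text \<open>Each item rests on the middle stack for one move only, so whatever lies there stays in
  place.\<close>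

lemma pour_through:
  assumes "length ps + length qs + 1 = k" "qs \<noteq> []"
  shows "(stack_step k)\<^sup>*\<^sup>* (ps @ (u @ s) # t # r # qs) (ps @ s # t # (rev u @ r) # qs)"
proof (induction u arbitrary: r)
  case (Cons x u)
  have "stack_step k (ps @ (x # u @ s) # t # r # qs) (ps @ (u @ s) # (x # t) # r # qs)"
    using assms by (intro stack_to_stack) auto
  moreover have "stack_step k (ps @ (u @ s) # (x # t) # r # qs) (ps @ (u @ s) # t # (x # r) # qs)"
    using stack_to_stack[of "ps @ [u @ s]" qs k x t r] assms by simp
  ultimately have "(stack_step k)\<^sup>*\<^sup>* (ps @ ((x # u) @ s) # t # r # qs) (ps @ (u @ s) # t # (x # r) # qs)"
    by simp
  with Cons[of "x # r"] show ?case
    by simp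
qed simp

text \<open>After \<open>u\<close> has gone past, \<open>x\<close> is parked in the second cell
  while \<open>v\<close> passes over it onto the third, giving \<open>rev v @ rev u\<close>. Then
  \<open>x\<close> goes on top, and pouring this pile into the fourth cell restores the order of
  \<open>u\<close> and \<open>v\<close> with \<open>x\<close> last. Since \<open>qs\<close> is
  nonempty, none of these cells is the output queue.\<close>

lemma three_stacks_move_to_end:
  assumes "length ps + length qs + 2 = k" "qs \<noteq> []"
  shows "(stack_step k)\<^sup>*\<^sup>* (ps @ (u @ x # v) # [] # [] # [] # qs)
           (ps @ [] # [] # [] # (u @ v @ [x]) # qs)"
proof -
  have "(stack_step k)\<^sup>*\<^sup>* (ps @ (u @ x # v) # [] # [] # [] # qs)
          (ps @ (x # v) # [] # rev u # [] # qs)"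
    using pour_through[of ps "[] # qs" k u "x # v" "[]" "[]"] assms by simp
  also have "(stack_step k)\<^sup>*\<^sup>* \<dots> (ps @ v # [x] # rev u # [] # qs)"
    using stack_to_stack[of ps "rev u # [] # qs" k x v "[]"] assms by auto
  also have "(stack_step k)\<^sup>*\<^sup>* \<dots> (ps @ [] # [x] # (rev v @ rev u) # [] # qs)"
    using pour_through[of ps "[] # qs" k v "[]" "[x]" "rev u"] assms by simp
  also have "(stack_step k)\<^sup>*\<^sup>* \<dots> (ps @ [] # [] # (x # rev v @ rev u) # [] # qs)"
    using stack_to_stack[of "ps @ [[]]" "[] # qs" k x "[]" "rev v @ rev u"] assms by auto
  also have "(stack_step k)\<^sup>*\<^sup>* \<dots> (ps @ [] # [] # [] # (u @ v @ [x]) # qs)"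
    using pour[of "ps @ [[], []]" qs k "x # rev v @ rev u" "[]" "[]"] assms by simp
  finally show ?thesis .
qed

text \<open>Selection sort: \<open>ws\<close> holds the items already placed, \<open>xs\<close>
  those still in front of them, and each entry of \<open>zs\<close> consumes three cells.\<close>

lemma move_all_to_end:
  assumes "mset xs = mset zs" "length ps + 3 * length zs + length qs = Suc k" "qs \<noteq> []"
  shows "(stack_step k)\<^sup>*\<^sup>* (ps @ (xs @ ws) # replicate (3 * length zs) [] @ qs)
           (ps @ replicate (3 * length zs) [] @ (ws @ zs) # qs)"
  using assms
proof (induction zs arbitrary: xs ps ws)
  case (Cons z zs)
  have "z \<in> set xs"
    using Cons.prems(1) by (metis list.set_intros(1) set_mset_mset)
  then obtain u v where xs: "xs = u @ z # v"
    by (meson split_list)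
  have ms: "mset (u @ v) = mset zs"
    using Cons.prems(1) by (simp add: xs)
  have three: "replicate (3 * length (z # zs)) [] = [[], [], []] @ replicate (3 * length zs) ([] :: nat list)"
    by (simp add: numeral_3_eq_3)
  have "(stack_step k)\<^sup>*\<^sup>* (ps @ (xs @ ws) # replicate (3 * length (z # zs)) [] @ qs)
      ((ps @ [[], [], []]) @ ((u @ v) @ ws @ [z]) # replicate (3 * length zs) [] @ qs)"
    using three_stacks_move_to_end[of ps "replicate (3 * length zs) [] @ qs" k u z "v @ ws"] Cons.prems
    unfolding three by (simp add: xs)
  also have "(stack_step k)\<^sup>*\<^sup>* \<dots>
      ((ps @ [[], [], []]) @ replicate (3 * length zs) [] @ ((ws @ [z]) @ zs) # qs)"
    using Cons.IH[OF ms, of "ps @ [[], [], []]" "ws @ [z]"] Cons.prems by simp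
  finally show ?case
    unfolding three by simp
qed simp

lemma unload_last_stack:
  "(stack_step k)\<^sup>*\<^sup>* (replicate k [] @ [xs, ys]) (replicate k [] @ [[], ys @ xs])"
proof (induction xs arbitrary: ys)
  case (Cons x xs)
  have "stack_step k (replicate k [] @ [x # xs, ys]) (replicate k [] @ [xs, ys @ [x]])"
    unfolding stack_step_iff by fastforce
  with Cons[of "ys @ [x]"] show ?case
    by (simp add: converse_rtranclp_into_rtranclp)
qed simp

lemma permutation_in_outputs:
  assumes "mset xs = mset zs"
  shows "zs \<in> outputs (3 * length zs) xs"
proof -
  have "(stack_step (3 * length zs))\<^sup>*\<^sup>* (loaded (3 * length zs) xs)
      (replicate (3 * length zs) [] @ [zs, []])"
    using move_all_to_end[OF assms, of "[]" "[[]]" "3 * length zs" "[]"] by simp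
  also have "(stack_step (3 * length zs))\<^sup>*\<^sup>* \<dots> (unloaded (3 * length zs) zs)"
    using unload_last_stack[of "3 * length zs" zs "[]"]
    by (simp flip: replicate_append_same)
  finally show ?thesis
    by (simp add: outputs_def)
qed

lemma Pgen_eq_outputs:
  "Pgen n k = {\<pi> \<in> Sym n. map \<pi> [1..<n + 1] \<in> outputs k [1..<n + 1]}"
  by (auto simp: Pgen_def Sym_def outputs_def init_config_def final_config_def)

lemma Pgen_stacks_needed: "Pgen n (stacks_needed n) = Sym n"
proof -
  have "map \<pi> [1..<n + 1] \<in> outputs (3 * n) [1..<n + 1]" if "\<pi> \<in> Sym n" for \<pi>
  proof -
    have perm: "\<pi> permutes {1..n}"
      using that by (simp add: Sym_def)
    have "mset [1..<n + 1] = mset_set {1..n}"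
      by (simp add: atLeastLessThanSuc_atLeastAtMost del: upt_Suc)
    then have "mset [1..<n + 1] = mset (map \<pi> [1..<n + 1])"
      using perm image_mset_mset_set[of \<pi> "{1..n}"]
      by (simp add: permutes_inj_on permutes_image del: upt_Suc)
    from permutation_in_outputs[OF this] show ?thesis
      by (simp del: upt_Suc)
  qed
  then have "Pgen n (3 * n) = Sym n"
    unfolding Pgen_eq_outputs by blast
  then show ?thesis
    unfolding stacks_needed_def by (rule LeastI)
qed

section \<open>Operation words for two stacks\<close>

datatype move = In | Tr | Out

type_synonym two_stacks = "nat list \<times> nat list \<times> nat list \<times> nat list"

fun exec1 :: "move \<Rightarrow> two_stacks \<Rightarrow> two_stacks option" where
  "exec1 In (x # i, s, t, out) = Some (i, x # s, t, out)"
| "exec1 Tr (i, x # s, t, out) = Some (i, s, x # t, out)"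
| "exec1 Out (i, s, x # t, out) = Some (i, s, t, out @ [x])"
| "exec1 _ _ = None"

fun exec :: "move list \<Rightarrow> two_stacks \<Rightarrow> two_stacks option" where
  "exec [] c = Some c"
| "exec (m # w) c = Option.bind (exec1 m c) (exec w)"

lemma exec_append: "exec (u @ w) c = Option.bind (exec u c) (exec w)"
  by (induction u arbitrary: c) (auto split: bind_splits)

lemma exec1_SomeE:
  assumes "exec1 m c = Some c'"
  obtains (In) x i s t out where "m = In" "c = (x # i, s, t, out)" "c' = (i, x # s, t, out)"
  | (Tr) x i s t out where "m = Tr" "c = (i, x # s, t, out)" "c' = (i, s, x # t, out)"
  | (Out) x i s t out where "m = Out" "c = (i, s, x # t, out)" "c' = (i, s, t, out @ [x])"
  using assms by (cases "(m, c)" rule: exec1.cases) auto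

text \<open>Conservation of items, cell by cell. A run from a full queue to empty stacks thus uses
  every move exactly once per item.\<close>

lemma exec_lengths:
  assumes "exec w (i, s, t, out) = Some (i', s', t', out')"
  shows "length i = length i' + count_list w In"
    "length s + count_list w In = length s' + count_list w Tr"
    "length t + count_list w Tr = length t' + count_list w Out"
    "length out' = length out + count_list w Out"
proof -
  have "length i = length i' + count_list w In \<and>
    length s + count_list w In = length s' + count_list w Tr \<and>
    length t + count_list w Tr = length t' + count_list w Out \<and>
    length out' = length out + count_list w Out"
    using assms
  proof (induction w arbitrary: i s t out)
    case (Cons m w)
    from Cons.prems obtain c where c: "exec1 m (i, s, t, out) = Some c"
      "exec w c = Some (i', s', t', out')"
      by (auto split: bind_splits)
    from c(1) show ?case
      by (cases rule: exec1_SomeE) (use c(2) Cons.IH in fastforce)+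
  qed simp
  then show "length i = length i' + count_list w In"
    "length s + count_list w In = length s' + count_list w Tr"
    "length t + count_list w Tr = length t' + count_list w Out"
    "length out' = length out + count_list w Out"
    by simp_all
qed

text \<open>If an item passes straight from stack 1 through stack 2 to the output, then a block of items
  that was carried over it just before can equally well be carried afterwards.\<close>

inductive reduces :: "move list \<Rightarrow> move list \<Rightarrow> bool" where
  "reduces [In, Out] [Out, In]"
| "reduces [In, Tr, Tr, Out] [Tr, Out, In, Tr]"
| "reduces [In, In, Tr, Tr, Tr, Out] [Tr, Out, In, In, Tr, Tr]"

lemma exec_reduces:
  assumes "reduces f g" "exec f c = Some c'"
  shows "exec g c = Some c'"
proof -
  obtain i s t out where c: "c = (i, s, t, out)"
    by (cases c)
  from assms(1) show ?thesis
  proof cases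
    case 1
    with assms(2) c show ?thesis
      by (cases i; cases t) auto
  next
    case 2
    with assms(2) c show ?thesis
      by (cases i; cases s) auto
  next
    case 3
    with assms(2) c show ?thesis
      by (cases i; cases "tl i"; cases s) auto
  qed
qed

definition reducible :: "move list \<Rightarrow> bool" where
  "reducible w \<longleftrightarrow> (\<exists>f g. reduces f g \<and> sublist f w)"

fun in_out_pairs :: "move list \<Rightarrow> nat" where
  "in_out_pairs [] = 0"
| "in_out_pairs (m # w) = (if m = In then count_list w Out else 0) + in_out_pairs w"

lemma in_out_pairs_append:
  "in_out_pairs (u @ w) = in_out_pairs u + in_out_pairs w + count_list u In * count_list w Out"
  by (induction u) auto

text \<open>Each rule keeps the number of each letter, so pairs involving the context are
  unaffected, and it moves an \<open>Out\<close> ahead of one or two \<open>In\<close>s.\<close>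

lemma in_out_pairs_reduces:
  assumes "reduces f g"
  shows "in_out_pairs (u @ g @ w) < in_out_pairs (u @ f @ w)"
  using assms by (cases rule: reduces.cases) (auto simp: in_out_pairs_append)

text \<open>A word minimising \<open>in_out_pairs\<close> among all words with the same effect
  contains no left-hand side, since rewriting it would give a smaller one.\<close>

lemma exec_irreducible:
  assumes "exec w c = Some c'"
  obtains w' where "exec w' c = Some c'" "\<not> reducible w'"
proof -
  obtain w' where w': "exec w' c = Some c'"
    and least: "\<And>v. exec v c = Some c' \<Longrightarrow> in_out_pairs w' \<le> in_out_pairs v"
    using ex_has_least_nat[of "\<lambda>v. exec v c = Some c'" w in_out_pairs] assms by blast
  have "\<not> reducible w'"
  proof
    assume "reducible w'"
    then obtain f g u v where fg: "reduces f g" and w'_eq: "w' = u @ f @ v"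
      by (auto simp: reducible_def sublist_def)
    have "exec (u @ g @ v) c = Some c'"
      using w' exec_reduces[OF fg] by (auto simp: w'_eq exec_append split: bind_splits)
    from least[OF this] in_out_pairs_reduces[OF fg, of u v] show False
      by (simp add: w'_eq)
  qed
  with w' that show thesis
    by blast
qed

section \<open>Runs of at most two stacks as words\<close>

lemma outputs_2_exec:
  assumes "ys \<in> outputs 2 xs"
  obtains w where "exec w (xs, [], [], []) = Some ([], [], [], ys)"
proof -
  have "\<exists>w i s t out. cs = [i, s, t, out] \<and> exec w (xs, [], [], []) = Some (i, s, t, out)"
    if "(stack_step 2)\<^sup>*\<^sup>* [xs, [], [], []] cs" for cs
    using that
  proof (induction rule: rtranclp_induct)
    case base
    show ?case
      by (auto intro: exI[of _ "[]"])
  next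
    case (step cs cs')
    then obtain w i s t out where cs: "cs = [i, s, t, out]"
      and w: "exec w (xs, [], [], []) = Some (i, s, t, out)"
      by blast
    obtain m i' s' t' out' where "cs' = [i', s', t', out']"
      "exec1 m (i, s, t, out) = Some (i', s', t', out')"
    proof -
      from step.hyps(2) obtain ps x a b qs where eq: "[i, s, t, out] = ps @ (x # a) # b # qs"
        "length ps + length qs = 2" "cs' = ps @ a # (if qs = [] then b @ [x] else x # b) # qs"
        unfolding stack_step_iff cs by blast
      then consider "ps = []" | "ps = [i]" | "ps = [i, s]"
        by (auto simp: Cons_eq_append_conv)
      then show thesis
      proof cases
        case 1
        with eq that[of a "x # b" t out In] show ?thesis by auto
      next
        case 2
        with eq that[of i a "x # b" out Tr] show ?thesis by auto
      next
        case 3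
        with eq that[of i s a "b @ [x]" Out] show ?thesis by auto
      qed
    qed
    with w show ?case
      by (intro exI[of _ "w @ [m]"] exI[of _ i'] exI[of _ s'] exI[of _ t'] exI[of _ out'])
        (simp add: exec_append)
  qed
  from this[of "[[], [], [], ys]"] assms that show thesis
    by (auto simp: outputs_def numeral_2_eq_2)
qed

text \<open>A single stack is simulated by two whose second stack is empty between moves: an output
  move becomes \<open>[Tr, Out]\<close>. A leftover stack thus obeys the bound for two.\<close>

lemma outputs_1_exec:
  assumes "ys \<in> outputs 1 xs"
  obtains w where "exec w (xs, [], [], []) = Some ([], [], [], ys)"
proof -
  have "\<exists>w i s out. cs = [i, s, out] \<and> exec w (xs, [], [], []) = Some (i, s, [], out)"
    if "(stack_step 1)\<^sup>*\<^sup>* [xs, [], []] cs" for cs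
    using that
  proof (induction rule: rtranclp_induct)
    case base
    show ?case
      by (auto intro: exI[of _ "[]"])
  next
    case (step cs cs')
    then obtain w i s out where cs: "cs = [i, s, out]"
      and w: "exec w (xs, [], [], []) = Some (i, s, [], out)"
      by blast
    obtain v i' s' out' where "cs' = [i', s', out']"
      "exec v (i, s, [], out) = Some (i', s', [], out')"
    proof -
      from step.hyps(2) obtain ps x a b qs where eq: "[i, s, out] = ps @ (x # a) # b # qs"
        "length ps + length qs = 1" "cs' = ps @ a # (if qs = [] then b @ [x] else x # b) # qs"
        unfolding stack_step_iff cs by blast
      then consider "ps = []" | "ps = [i]"
        by (auto simp: Cons_eq_append_conv)
      then show thesis
      proof cases
        case 1
        with eq that[of a "x # b" out "[In]"] show ?thesis by auto
      next
        case 2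
        with eq that[of i a "b @ [x]" "[Tr, Out]"] show ?thesis by auto
      qed
    qed
    with w show ?case
      by (intro exI[of _ "w @ v"] exI[of _ i'] exI[of _ s'] exI[of _ out']) (simp add: exec_append)
  qed
  from this[of "[[], [], ys]"] assms that show thesis
    by (auto simp: outputs_def)
qed

lemma outputs_0: "outputs 0 xs \<subseteq> {xs}"
proof -
  have "\<exists>i out. cs = [i, out] \<and> out @ i = xs" if "(stack_step 0)\<^sup>*\<^sup>* [xs, []] cs" for cs
    using that
  proof (induction rule: rtranclp_induct)
    case (step cs cs')
    from step.hyps(2) step.IH show ?case
      unfolding stack_step_iff by auto
  qed simp
  then show ?thesis
    by (fastforce simp: outputs_def)
qed

section \<open>Counting irreducible words\<close>

text \<open>The states of the automaton recognising irreducible words are the proper prefixes of the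
  left-hand sides of the rewriting rules.\<close>

datatype state = S | SI | SII | SIT | SITT | SIIT | SIITT | SIITTT

fun label :: "state \<Rightarrow> move list" where
  "label S = []"
| "label SI = [In]"
| "label SII = [In, In]"
| "label SIT = [In, Tr]"
| "label SITT = [In, Tr, Tr]"
| "label SIIT = [In, In, Tr]"
| "label SIITT = [In, In, Tr, Tr]"
| "label SIITTT = [In, In, Tr, Tr, Tr]"

text \<open>An Aho-Corasick automaton: the next state is the longest suffix of
  \<open>label q @ [m]\<close> that is again a label, and \<open>None\<close> means that a left-hand
  side has just been completed.\<close>

fun delta :: "state \<Rightarrow> move \<Rightarrow> state option" where
  "delta S In = Some SI"
| "delta SI In = Some SII"
| "delta SII In = Some SII"
| "delta _ In = Some SI"
| "delta SI Tr = Some SIT"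
| "delta SII Tr = Some SIIT"
| "delta SIT Tr = Some SITT"
| "delta SIIT Tr = Some SIITT"
| "delta SIITT Tr = Some SIITTT"
| "delta _ Tr = Some S"
| "delta S Out = Some S"
| "delta SIT Out = Some S"
| "delta SIIT Out = Some S"
| "delta _ Out = None"

fun accepted :: "state \<Rightarrow> move list \<Rightarrow> bool" where
  "accepted q [] \<longleftrightarrow> True"
| "accepted q (m # w) \<longleftrightarrow> (case delta q m of None \<Rightarrow> False | Some q' \<Rightarrow> accepted q' w)"

lemma delta_None:
  assumes "delta q m = None"
  shows "reducible (label q @ [m])"
proof -
  have "sublist [In, Out] (label q @ [m]) \<or> sublist [In, Tr, Tr, Out] (label q @ [m]) \<or>
    sublist [In, In, Tr, Tr, Tr, Out] (label q @ [m])"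
    using assms by (cases q; cases m) (auto simp: sublist_Cons_right)
  then show ?thesis
    unfolding reducible_def by (blast intro: reduces.intros)
qed

lemma delta_Some:
  assumes "delta q m = Some q'"
  shows "suffix (label q') (label q @ [m])"
  using assms by (cases q; cases m) (auto simp: suffix_Cons)

lemma reducible_mono: "reducible u \<Longrightarrow> sublist u w \<Longrightarrow> reducible w"
  unfolding reducible_def by (meson sublist_order.order_trans)

text \<open>The state is always a suffix of the word read so far, so forgetting the earlier letters
  leaves a factor of an irreducible word; a missing transition would exhibit a forbidden
  factor.\<close>

lemma irreducible_accepted: "\<not> reducible (label q @ w) \<Longrightarrow> accepted q w"
proof (induction w arbitrary: q)
  case (Cons m w)
  have eq: "label q @ m # w = (label q @ [m]) @ w"
    by simp
  show ?case
  proof (cases "delta q m")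
    case None
    have "sublist (label q @ [m]) (label q @ m # w)"
      unfolding eq by (intro sublist_append_rightI)
    with Cons.prems reducible_mono delta_None[OF None] show ?thesis
      by blast
  next
    case (Some q')
    obtain u where "label q @ [m] = u @ label q'"
      using delta_Some[OF Some] by (auto simp: suffix_def)
    then have "label q @ m # w = u @ (label q' @ w)"
      unfolding eq by simp
    then have "sublist (label q' @ w) (label q @ m # w)"
      by (metis sublist_append_leftI)
    with Cons.prems reducible_mono have "\<not> reducible (label q' @ w)"
      by blast
    with Cons.IH Some show ?thesis
      by simp
  qed
qed simp

section \<open>Weighted count of accepted words\<close>

text \<open>The product of the three weights is 27/400, whose inverse becomes the growth rate: the
  larger the product for which a superharmonic potential still exists, the better the bound.\<close>

fun weight :: "move \<Rightarrow> real" where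
  "weight In = 1 / 2"
| "weight Tr = 27 / 100"
| "weight Out = 1 / 2"

text \<open>A superharmonic function for the weighted automaton: an approximate Perron eigenvector,
  rounded up and scaled so that all entries are at least 1.\<close>

fun potential :: "state \<Rightarrow> real" where
  "potential S = 3"
| "potential SI = 1.38"
| "potential SII = 1.343"
| "potential SIT = 2.595"
| "potential SITT = 1.5"
| "potential SIIT = 2.486"
| "potential SIITT = 1.095"
| "potential SIITTT = 1.5"

definition next_potential :: "state \<Rightarrow> move \<Rightarrow> real" where
  "next_potential q m = (case delta q m of None \<Rightarrow> 0 | Some q' \<Rightarrow> weight m * potential q')"

lemma potential_superharmonic:
  "next_potential q In + next_potential q Tr + next_potential q Out \<le> potential q"
  by (cases q) (auto simp: next_potential_def)

definition word_weight :: "move list \<Rightarrow> real" where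
  "word_weight w = prod_list (map weight w)"

definition accepted_words :: "state \<Rightarrow> nat \<Rightarrow> move list set" where
  "accepted_words q l = {w. length w = l \<and> accepted q w}"

lemma UNIV_move: "(UNIV :: move set) = {In, Tr, Out}"
  using move.exhaust by auto

lemma finite_accepted_words: "finite (accepted_words q l)"
proof -
  have "finite {w. set w \<subseteq> (UNIV :: move set) \<and> length w = l}"
    by (rule finite_lists_length_eq) (simp add: UNIV_move)
  then show ?thesis
    by (rule rev_finite_subset) (auto simp: accepted_words_def)
qed

text \<open>Splitting off the first letter, superharmonicity carries the bound from length
  \<open>l\<close> to \<open>Suc l\<close>. For length 0 the empty word has weight 1, and all
  potentials are at least 1.\<close>

lemma sum_word_weight_le: "(\<Sum>w \<in> accepted_words q l. word_weight w) \<le> potential q"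
proof (induction l arbitrary: q)
  case 0
  have "accepted_words q 0 = {[]}"
    by (auto simp: accepted_words_def)
  then show ?case
    by (cases q) (auto simp: word_weight_def)
next
  case (Suc l)
  define after where "after m = {w. m # w \<in> accepted_words q (Suc l)}" for m
  have after: "after m = (case delta q m of None \<Rightarrow> {} | Some q' \<Rightarrow> accepted_words q' l)" for m
    by (auto simp: after_def accepted_words_def split: option.splits)
  have fin: "finite (after m)" for m
    unfolding after by (auto split: option.split simp: finite_accepted_words)
  have part: "(\<Sum>w \<in> (#) m ` after m. word_weight w) \<le> next_potential q m" for m
  proof -
    have pos: "weight m \<ge> 0"
      by (cases m) auto
    have "(\<Sum>w \<in> (#) m ` after m. word_weight w) = (\<Sum>w \<in> after m. weight m * word_weight w)"
      by (subst sum.reindex) (auto simp: word_weight_def)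
    also have "\<dots> = weight m * (\<Sum>w \<in> after m. word_weight w)"
      by (simp add: sum_distrib_left)
    also have "\<dots> \<le> next_potential q m"
      unfolding after next_potential_def
      by (auto split: option.split intro!: mult_left_mono Suc.IH pos)
    finally show ?thesis .
  qed
  have "accepted_words q (Suc l) = (\<Union>m \<in> {In, Tr, Out}. (#) m ` after m)"
  proof (intro equalityI subsetI)
    fix w assume w: "w \<in> accepted_words q (Suc l)"
    then obtain m v where "w = m # v"
      by (cases w) (auto simp: accepted_words_def)
    with w have "w \<in> (#) m ` after m"
      by (auto simp: after_def)
    then show "w \<in> (\<Union>m \<in> {In, Tr, Out}. (#) m ` after m)"
      by (cases m) auto
  qed (auto simp: after_def)
  then have "(\<Sum>w \<in> accepted_words q (Suc l). word_weight w)
      = (\<Sum>m \<in> {In, Tr, Out}. \<Sum>w \<in> (#) m ` after m. word_weight w)"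
    using fin by (simp only:) (rule sum.UNION_disjoint, auto)
  also have "\<dots> \<le> (\<Sum>m \<in> {In, Tr, Out}. next_potential q m)"
    by (intro sum_mono part)
  also have "\<dots> \<le> potential q"
    using potential_superharmonic[of q] by simp
  finally show ?case .
qed

lemma word_weight_eq:
  "word_weight w = (1 / 2) ^ count_list w In * (27 / 100) ^ count_list w Tr * (1 / 2) ^ count_list w Out"
proof (induction w)
  case (Cons m w)
  then show ?case
    by (cases m) (auto simp: word_weight_def)
qed (simp add: word_weight_def)

lemma length_move_word: "length w = count_list w In + count_list w Tr + count_list w Out"
proof (induction w)
  case (Cons m w)
  then show ?case
    by (cases m) auto
qed simp

definition canonical_words :: "nat \<Rightarrow> move list set" where
  "canonical_words n = {w. \<not> reducible w \<and>
     count_list w In = n \<and> count_list w Tr = n \<and> count_list w Out = n}"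

lemma canonical_words_subset: "canonical_words n \<subseteq> accepted_words S (3 * n)"
  using irreducible_accepted[of S]
  by (auto simp: canonical_words_def accepted_words_def length_move_word)

text \<open>All canonical words have the same weight \<open>(27 / 400) ^ n\<close>, and together
  they weigh at most \<open>potential S\<close>, which is 3.\<close>

lemma card_canonical_words: "real (card (canonical_words n)) \<le> 3 * (400 / 27) ^ n"
proof -
  have ww: "word_weight w = (27 / 400) ^ n" if "w \<in> canonical_words n" for w
    using that
    by (auto simp: canonical_words_def word_weight_eq simp flip: power_mult_distrib)
  have "real (card (canonical_words n)) * (27 / 400) ^ n = (\<Sum>w \<in> canonical_words n. word_weight w)"
    by (simp add: ww)
  also have "\<dots> \<le> (\<Sum>w \<in> accepted_words S (3 * n). word_weight w)"
    by (intro sum_mono2 finite_accepted_words canonical_words_subset) (auto simp: word_weight_eq)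
  also have "\<dots> \<le> 3"
    using sum_word_weight_le[of S] by simp
  finally show ?thesis
    by (simp add: power_divide field_simps)
qed

lemma exec_canonical:
  assumes "exec w (xs, [], [], []) = Some ([], [], [], ys)"
  obtains w' where "w' \<in> canonical_words (length xs)"
    "exec w' (xs, [], [], []) = Some ([], [], [], ys)" "length ys = length xs"
proof -
  from exec_irreducible[OF assms] obtain w'
    where w': "exec w' (xs, [], [], []) = Some ([], [], [], ys)" "\<not> reducible w'"
    by blast
  with exec_lengths[OF w'(1)] that[of w'] show thesis
    by (simp add: canonical_words_def)
qed

section \<open>From words to the outputs of k stacks\<close>

text \<open>Defined by words rather than as \<open>outputs 2 xs\<close>, so that it also covers a
  single stack.\<close>

definition two_stack_outputs :: "nat list \<Rightarrow> nat list set" where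
  "two_stack_outputs xs = {ys. \<exists>w. exec w (xs, [], [], []) = Some ([], [], [], ys)}"

lemma two_stack_outputs_bound:
  shows "finite (two_stack_outputs xs)"
    and "card (two_stack_outputs xs) \<le> card (canonical_words (length xs))"
    and "ys \<in> two_stack_outputs xs \<Longrightarrow> length ys = length xs"
proof -
  \<comment> \<open>Decodes a word into its output. On an illegal word the value is arbitrary, which
    is harmless because only an inclusion into the image is claimed.\<close>
  let ?f = "\<lambda>w. snd (snd (snd (the (exec w (xs, [], [], [])))))"
  have fin: "finite (canonical_words (length xs))"
    using canonical_words_subset finite_accepted_words by (rule finite_subset)
  have sub: "two_stack_outputs xs \<subseteq> ?f ` canonical_words (length xs)"
  proof
    fix ys assume "ys \<in> two_stack_outputs xs"
    then obtain w' where "w' \<in> canonical_words (length xs)"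
      "exec w' (xs, [], [], []) = Some ([], [], [], ys)"
      unfolding two_stack_outputs_def using exec_canonical by blast
    then show "ys \<in> ?f ` canonical_words (length xs)"
      by (intro image_eqI[of _ _ w']) auto
  qed
  show "finite (two_stack_outputs xs)"
    using sub fin by (meson finite_imageI finite_subset)
  show "card (two_stack_outputs xs) \<le> card (canonical_words (length xs))"
    using sub fin by (rule surj_card_le[rotated])
  show "length ys = length xs" if "ys \<in> two_stack_outputs xs"
    using that unfolding two_stack_outputs_def using exec_canonical by blast
qed

text \<open>The first two stacks are peeled off repeatedly. Each block preserves the length of the
  sequence, so every block costs the same factor; an odd stack at the end costs a full factor,
  whence the exponent is k/2 rounded up.\<close>

lemma outputs_bound:
  "finite (outputs k xs) \<and> card (outputs k xs) \<le> card (canonical_words (length xs)) ^ ((k + 1) div 2)"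
proof (induction k arbitrary: xs rule: less_induct)
  case (less k)
  consider "k = 0" | "k = 1" | k' where "k = 2 + k'"
    by (metis One_nat_def add_2_eq_Suc not0_implies_Suc)
  then show ?case
  proof cases
    case 1
    have "finite (outputs 0 xs)" "card (outputs 0 xs) \<le> 1"
      using outputs_0[of xs] card_mono[of "{xs}" "outputs 0 xs"]
      by (auto intro: finite_subset)
    then show ?thesis
      using 1 by simp
  next
    case 2
    have "outputs 1 xs \<subseteq> two_stack_outputs xs"
      unfolding two_stack_outputs_def using outputs_1_exec by blast
    then have "finite (outputs 1 xs)" "card (outputs 1 xs) \<le> card (two_stack_outputs xs)"
      using two_stack_outputs_bound(1) by (auto intro: finite_subset card_mono)
    then show ?thesis
      using 2 two_stack_outputs_bound(2)[of xs] by simp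
  next
    case 3
    let ?N = "card (canonical_words (length xs))"
    let ?U = "\<Union>ys \<in> two_stack_outputs xs. outputs k' ys"
    have IH: "finite (outputs k' ys)" "card (outputs k' ys) \<le> ?N ^ ((k' + 1) div 2)"
      if "ys \<in> two_stack_outputs xs" for ys
      using less.IH[of k' ys] 3 two_stack_outputs_bound(3)[OF that] by simp_all
    have sub: "outputs k xs \<subseteq> ?U"
    proof
      fix zs assume "zs \<in> outputs k xs"
      then obtain ys where "ys \<in> outputs 2 xs" "zs \<in> outputs k' ys"
        unfolding 3 by (rule outputs_split)
      moreover from this(1) have "ys \<in> two_stack_outputs xs"
        by (rule outputs_2_exec) (auto simp: two_stack_outputs_def)
      ultimately show "zs \<in> ?U"
        by blast
    qed
    have finU: "finite ?U"
      by (rule finite_UN_I[OF two_stack_outputs_bound(1) IH(1)])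
    have fin: "finite (outputs k xs)"
      using sub finU by (rule finite_subset)
    have "card (outputs k xs) \<le> card ?U"
      using finU sub by (rule card_mono)
    also have "card ?U \<le> (\<Sum>ys \<in> two_stack_outputs xs. card (outputs k' ys))"
      by (rule card_UN_le) (rule two_stack_outputs_bound)
    also have "\<dots> \<le> card (two_stack_outputs xs) * ?N ^ ((k' + 1) div 2)"
      using sum_bounded_above[of "two_stack_outputs xs" "\<lambda>ys. card (outputs k' ys)", OF IH(2)] by simp
    also have "\<dots> \<le> ?N * ?N ^ ((k' + 1) div 2)"
      by (intro mult_right_mono two_stack_outputs_bound) simp
    finally show ?thesis
      using fin 3 by simp
  qed
qed

lemma fact_le_canonical_words:
  "fact n \<le> card (canonical_words n) ^ ((stacks_needed n + 1) div 2)"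
proof -
  let ?k = "stacks_needed n" and ?g = "\<lambda>\<pi>. map \<pi> [1..<n + 1]"
  have inj: "inj_on ?g (Sym n)"
  proof (rule inj_onI)
    fix \<pi> \<sigma> :: "nat \<Rightarrow> nat"
    assume "\<pi> \<in> Sym n" "\<sigma> \<in> Sym n" "?g \<pi> = ?g \<sigma>"
    then have "\<pi> permutes {1..n}" "\<sigma> permutes {1..n}" "\<forall>i \<in> {1..n}. \<pi> i = \<sigma> i"
      by (auto simp: Sym_def simp del: upt_Suc)
    then show "\<pi> = \<sigma>"
      by (metis ext permutes_not_in)
  qed
  have "?g ` Sym n \<subseteq> outputs ?k [1..<n + 1]"
    using Pgen_stacks_needed[of n] unfolding Pgen_eq_outputs by blast
  then have "card (Sym n) \<le> card (outputs ?k [1..<n + 1])"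
    using inj outputs_bound card_inj_on_le by blast
  also have "\<dots> \<le> card (canonical_words n) ^ ((?k + 1) div 2)"
    using outputs_bound[of ?k "[1..<n + 1]"] by (simp del: upt_Suc)
  finally show ?thesis
    by (simp add: Sym_def card_permutations)
qed

section \<open>The asymptotic bound\<close>

text \<open>The single term n^n / n! of the exponential series is at most e^n; taking logarithms
  gives the claim.\<close>

lemma ln_fact_ge:
  assumes "n \<ge> 1"
  shows "real n * (ln (real n) - 1) \<le> ln (fact n)"
proof -
  have "(\<Sum>m \<in> {n}. real n ^ m /\<^sub>R fact m) \<le> (\<Sum>m. real n ^ m /\<^sub>R fact m)"
    by (intro sum_le_suminf sums_summable[OF exp_converges]) auto
  then have "real n ^ n / fact n \<le> exp (real n)"
    by (simp add: exp_def divide_inverse mult.commute)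
  then have "ln (real n ^ n / fact n) \<le> ln (exp (real n))"
    using assms by (subst ln_le_cancel_iff) simp_all
  then show ?thesis
    using assms by (simp add: ln_div ln_realpow algebra_simps)
qed

theorem theorem2:
  shows "\<exists>C::real. \<forall>n::nat. n \<ge> 1 \<longrightarrow>
           real (stacks_needed n) \<ge> 2 * log 2 (real n) / log 2 14.864 - C"
proof -
  define L :: real where "L = ln 14.864"
  have L: "L > 0"
    by (simp add: L_def)
  \<comment> \<open>The base 14.864 * 27/400 is slightly above 1, so for large \<open>n\<close> its
    powers absorb the factor 3 of \<open>card_canonical_words\<close>.\<close>
  have "\<exists>n0. \<forall>n \<ge> n0. 3 \<le> (14.864 * 27 / 400 :: real) ^ n"
  proof -
    obtain n0 where "(3 :: real) < (14.864 * 27 / 400) ^ n0"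
      using real_arch_pow[of "14.864 * 27 / 400 :: real" 3] by auto
    moreover have "(14.864 * 27 / 400 :: real) ^ n0 \<le> (14.864 * 27 / 400) ^ n" if "n \<ge> n0" for n
      using that by (intro power_increasing) auto
    ultimately show ?thesis
      by (meson less_imp_le order_trans)
  qed
  then obtain n0 where n0: "\<And>n. n \<ge> n0 \<Longrightarrow> 3 \<le> (14.864 * 27 / 400 :: real) ^ n"
    by blast
  have eq: "2 * log 2 (real n) / log 2 14.864 = 2 * ln (real n) / L" for n
    by (simp add: log_def L_def)
  \<comment> \<open>The constant results from solving
    \<open>ln n - 1 \<le> (stacks_needed n + 1) / 2 * L\<close> for
    \<open>stacks_needed n\<close>.\<close>
  have large: "2 * ln (real n) / L - (2 / L + 1) \<le> real (stacks_needed n)" if n: "n \<ge> n0" "n \<ge> 1" for n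
  proof -
    let ?h = "(stacks_needed n + 1) div 2"
    have "real (card (canonical_words n)) \<le> 3 * (400 / 27) ^ n"
      by (rule card_canonical_words)
    also have "\<dots> \<le> (14.864 * 27 / 400) ^ n * (400 / 27) ^ n"
      using n0[OF n(1)] by (intro mult_right_mono) auto
    also have "\<dots> = 14.864 ^ n"
      by (simp flip: power_mult_distrib)
    finally have N: "real (card (canonical_words n)) \<le> 14.864 ^ n" .
    have "fact n \<le> real (card (canonical_words n)) ^ ?h"
      using fact_le_canonical_words[of n] by (metis of_nat_fact of_nat_le_iff of_nat_power)
    also have "\<dots> \<le> (14.864 ^ n) ^ ?h"
      using N by (intro power_mono) auto
    finally have "ln (fact n) \<le> ln ((14.864 ^ n) ^ ?h :: real)"
      by (subst ln_le_cancel_iff) auto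
    also have "\<dots> = real n * (real ?h * L)"
      by (simp add: ln_realpow L_def)
    finally have "real n * (ln (real n) - 1) \<le> real n * (real ?h * L)"
      using ln_fact_ge[OF n(2)] by linarith
    then have "ln (real n) - 1 \<le> real ?h * L"
      using n(2) by simp
    also have "\<dots> \<le> (real (stacks_needed n) + 1) / 2 * L"
    proof (intro mult_right_mono)
      have "2 * ?h \<le> stacks_needed n + 1"
        by simp
      then have "real (2 * ?h) \<le> real (stacks_needed n + 1)"
        by (simp only: of_nat_le_iff)
      then show "real ?h \<le> (real (stacks_needed n) + 1) / 2"
        by simp
    qed (use L in simp)
    finally show ?thesis
      using L by (simp add: field_simps)
  qed
  show ?thesis
  \<comment> \<open>The additional summand covers the finitely many \<open>n\<close> below
    \<open>n0\<close>, where the main term is at most this summand; \<open>n0 + 1\<close> keeps the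
    logarithm nonnegative even for \<open>n0 = 0\<close>.\<close>
  proof (intro exI[of _ "2 / L + 1 + 2 * ln (real (n0 + 1)) / L"] allI impI)
    fix n :: nat assume n: "n \<ge> 1"
    have pos: "0 \<le> 2 * ln (real (n0 + 1)) / L" "0 \<le> 2 / L"
      using L by auto
    show "real (stacks_needed n) \<ge> 2 * log 2 (real n) / log 2 14.864 - (2 / L + 1 + 2 * ln (real (n0 + 1)) / L)"
    proof (cases "n \<ge> n0")
      case True
      from large[OF this n] pos show ?thesis
        unfolding eq by linarith
    next
      case False
      then have "2 * ln (real n) / L \<le> 2 * ln (real (n0 + 1)) / L"
        using n L by (intro divide_right_mono mult_left_mono) auto
      with pos show ?thesis
        unfolding eq by linarith
    qed
  qed
qed

end
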